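(* Let $M$ be a 7-dimensional manifold with an arbitrary $G_2^*$ structure $\varphi$, let $\xi$ be a vector field on $M$ with $g_{4,3}(\xi,\xi)=-1$, and let $(\phi,\xi,\eta,g)$ be the almost paracontact metric structure induced by $\varphi$ and $\xi$. Then the component $F^{12}$ of $\nabla\Phi$ vanishes identically if and only if $\nabla_\xi\xi=0$.
   Context: $G_2^*$ structures: on $\mathbb{R}^7$ with standard basis $e_1,\dots,e_7$ and dual basis $e^1,\dots,e^7$, let $g_{4,3}$ be the metric of signature $(-,-,-,-,+,+,+)$ for which the basis is orthonormal (the first four vectors having square $-1$), and let $\varphi_0=-e^{127}-e^{135}+e^{146}+e^{236}+e^{245}-e^{347}+e^{567}$, where $e^{ijk}=e^i\wedge e^j\wedge e^k$. $G_2^*$ is the stabilizer of $\varphi_0$ in $GL(7,\mathbb{R})$; it preserves $g_{4,3}$. A $G_2^*$ structure on a smooth oriented 7-manifold $M$ is a smooth 3-form $\varphi$ such that $(T_pM,\varphi_p)$ is isomorphic to $(\mathbb{R}^7,\varphi_0)$ for every $p\in M$. It induces a semi-Riemannian metric, also denoted $g_{4,3}$ (transported pointwise through these isomorphisms), and a cross product $P$ defined by $\varphi(X,Y,Z)=g_{4,3}(P(X,Y),Z)$. Induced almost paracontact metric structure: given a vector field $\xi$ with $g_{4,3}(\xi,\xi)=-1$, set $\phi(X)=P(\xi,X)$, $g=-g_{4,3}$, $\eta(X)=g(\xi,X)$. Then $\phi^2=I-\eta\otimes\xi$, $\eta(\xi)=1$, $g(\phi X,\phi Y)=-g(X,Y)+\eta(X)\eta(Y)$.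 The metrics $g$ and $g_{4,3}$ have the same Levi-Civita connection $\nabla$. The fundamental 2-form is $\Phi(X,Y)=g(\phi X,Y)$ and $F(X,Y,Z)=(\nabla_X\Phi)(Y,Z)$. The component (projection) of $F$ on the class $\mathbb{G}_{12}$ of the classification of almost paracontact metric structures is $$F^{12}(X,Y,Z)=\eta(X)\{\eta(Y)F(\xi,\xi,\phi^2Z)-\eta(Z)F(\xi,\xi,\phi^2Y)\}.$$ $X,Y,Z$ denote arbitrary vector fields. *)

theory Defs
  imports "HOL-Analysis.Analysis"
begin

section \<open>Smooth maps between Euclidean spaces\<close>

text \<open>For an open set S, \<open>Ck_on k f S\<close> says that f is k times continuously differentiable on S:
  the directional derivatives of f in all directions are again of class C^(k-1).\<close>

primrec Ck_on ::
  "nat \<Rightarrow> ('a::euclidean_space \<Rightarrow> 'b::real_normed_vector) \<Rightarrow> 'a set \<Rightarrow> bool" where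
  "Ck_on 0 f S \<longleftrightarrow> continuous_on S f"
| "Ck_on (Suc k) f S \<longleftrightarrow>
     f differentiable_on S \<and> (\<forall>v. Ck_on k (\<lambda>x. frechet_derivative f (at x) v) S)"

definition smooth_on ::
  "('a::euclidean_space \<Rightarrow> 'b::real_normed_vector) \<Rightarrow> 'a set \<Rightarrow> bool" where
  "smooth_on f S \<longleftrightarrow> (\<forall>k. Ck_on k f S)"


section \<open>Smooth oriented 7-manifolds\<close>

text \<open>The manifold M is a whole type; a chart is a pair of an open domain and a coordinate map,
  which is only relevant on that domain.\<close>

type_synonym 'm chart = "'m set \<times> ('m \<Rightarrow> real^7)"
type_synonym 'm tangent = "('m \<Rightarrow> real) \<Rightarrow> real"
type_synonym 'm vfield = "'m \<Rightarrow> 'm tangent"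

definition is_chart :: "('m::topological_space) chart \<Rightarrow> bool" where
  "is_chart c \<longleftrightarrow> (case c of (U, x) \<Rightarrow>
     open U \<and> open (x ` U) \<and> (\<exists>y. homeomorphism U (x ` U) x y))"

definition transition :: "'m chart \<Rightarrow> 'm chart \<Rightarrow> real^7 \<Rightarrow> real^7" where
  "transition c d = snd d \<circ> inv_into (fst c) (snd c)"

definition overlap :: "'m chart \<Rightarrow> 'm chart \<Rightarrow> (real^7) set" where
  "overlap c d = snd c ` (fst c \<inter> fst d)"

definition smooth_oriented_manifold ::
  "('m::{t2_space, second_countable_topology}) chart set \<Rightarrow> bool" where
  "smooth_oriented_manifold A \<longleftrightarrow>
     (\<forall>c\<in>A. is_chart c) \<and>
     (\<Union>c\<in>A. fst c) = UNIV \<and>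
     (\<forall>c\<in>A. \<forall>d\<in>A. smooth_on (transition c d) (overlap c d) \<and>
        (\<forall>x\<in>overlap c d. det (matrix (frechet_derivative (transition c d) (at x))) > 0))"

definition smooth_functions :: "'m chart set \<Rightarrow> ('m \<Rightarrow> real) set" where
  "smooth_functions A =
     {f. \<forall>c\<in>A. smooth_on (f \<circ> inv_into (fst c) (snd c)) (snd c ` fst c)}"


section \<open>Tangent vectors and vector fields\<close>

text \<open>A tangent vector at p is a derivation at p of the algebra of smooth functions on M. It is
  normalised to take the value 0 on non-smooth functions, so that equality of tangent vectors is
  equality in HOL.\<close>

definition tangent_space :: "'m chart set \<Rightarrow> 'm \<Rightarrow> 'm tangent set" where
  "tangent_space A p = {v.
     (\<forall>f\<in>smooth_functions A. \<forall>h\<in>smooth_functions A.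
        v (\<lambda>q. f q + h q) = v f + v h \<and>
        v (\<lambda>q. f q * h q) = f p * v h + h p * v f) \<and>
     (\<forall>f\<in>smooth_functions A. \<forall>a. v (\<lambda>q. a * f q) = a * v f) \<and>
     (\<forall>f. f \<notin> smooth_functions A \<longrightarrow> v f = 0)}"

definition tzero :: "'m tangent" where
  "tzero = (\<lambda>f. 0)"

definition tadd :: "'m tangent \<Rightarrow> 'm tangent \<Rightarrow> 'm tangent" where
  "tadd u v = (\<lambda>f. u f + v f)"

definition tscale :: "real \<Rightarrow> 'm tangent \<Rightarrow> 'm tangent" where
  "tscale a u = (\<lambda>f. a * u f)"

definition deriv_along :: "'m vfield \<Rightarrow> ('m \<Rightarrow> real) \<Rightarrow> 'm \<Rightarrow> real" where
  "deriv_along X f = (\<lambda>p. X p f)"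

definition vector_fields :: "'m chart set \<Rightarrow> 'm vfield set" where
  "vector_fields A = {X. (\<forall>p. X p \<in> tangent_space A p) \<and>
     (\<forall>f\<in>smooth_functions A. deriv_along X f \<in> smooth_functions A)}"

definition vadd :: "'m vfield \<Rightarrow> 'm vfield \<Rightarrow> 'm vfield" where
  "vadd X Y = (\<lambda>p. tadd (X p) (Y p))"

definition vscale :: "('m \<Rightarrow> real) \<Rightarrow> 'm vfield \<Rightarrow> 'm vfield" where
  "vscale f X = (\<lambda>p. tscale (f p) (X p))"

definition lie_bracket :: "'m vfield \<Rightarrow> 'm vfield \<Rightarrow> 'm vfield" where
  "lie_bracket X Y =
     (\<lambda>p f. deriv_along X (deriv_along Y f) p - deriv_along Y (deriv_along X f) p)"


section \<open>The Levi-Civita connection\<close>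

type_synonym 'm form2 = "'m \<Rightarrow> 'm tangent \<Rightarrow> 'm tangent \<Rightarrow> real"
type_synonym 'm form3 = "'m \<Rightarrow> 'm tangent \<Rightarrow> 'm tangent \<Rightarrow> 'm tangent \<Rightarrow> real"

definition connection :: "'m chart set \<Rightarrow> ('m vfield \<Rightarrow> 'm vfield \<Rightarrow> 'm vfield) \<Rightarrow> bool" where
  "connection A D \<longleftrightarrow>
     (\<forall>X\<in>vector_fields A. \<forall>Y\<in>vector_fields A. D X Y \<in> vector_fields A) \<and>
     (\<forall>X\<in>vector_fields A. \<forall>X'\<in>vector_fields A. \<forall>Y\<in>vector_fields A.
        D (vadd X X') Y = vadd (D X Y) (D X' Y) \<and>
        D Y (vadd X X') = vadd (D Y X) (D Y X')) \<and>
     (\<forall>f\<in>smooth_functions A. \<forall>X\<in>vector_fields A. \<forall>Y\<in>vector_fields A.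
        D (vscale f X) Y = vscale f (D X Y) \<and>
        D X (vscale f Y) = vadd (vscale (deriv_along X f) Y) (vscale f (D X Y)))"

definition levi_civita ::
  "'m chart set \<Rightarrow> 'm form2 \<Rightarrow> ('m vfield \<Rightarrow> 'm vfield \<Rightarrow> 'm vfield) \<Rightarrow> bool" where
  "levi_civita A g D \<longleftrightarrow> connection A D \<and>
     (\<forall>X\<in>vector_fields A. \<forall>Y\<in>vector_fields A.
        D X Y = vadd (lie_bracket X Y) (D Y X)) \<and>
     (\<forall>X\<in>vector_fields A. \<forall>Y\<in>vector_fields A. \<forall>Z\<in>vector_fields A. \<forall>p.
        deriv_along X (\<lambda>q. g q (Y q) (Z q)) p
          = g p (D X Y p) (Z p) + g p (Y p) (D X Z p))"

definition nabla_form2 ::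
  "('m vfield \<Rightarrow> 'm vfield \<Rightarrow> 'm vfield) \<Rightarrow> 'm form2 \<Rightarrow>
     'm vfield \<Rightarrow> 'm vfield \<Rightarrow> 'm vfield \<Rightarrow> 'm \<Rightarrow> real" where
  "nabla_form2 D B X Y Z = (\<lambda>p.
     deriv_along X (\<lambda>q. B q (Y q) (Z q)) p - B p (D X Y p) (Z p) - B p (Y p) (D X Z p))"


section \<open>The model on \<open>\<real>\<^sup>7\<close>\<close>

text \<open>The index 7 of type 7 is the residue class of 0, so the seven indices 1, ..., 7 are
  pairwise distinct. Wedge products of covectors are taken without a factorial factor.\<close>

definition g0 :: "real^7 \<Rightarrow> real^7 \<Rightarrow> real" where
  "g0 x y = - x$1 * y$1 - x$2 * y$2 - x$3 * y$3 - x$4 * y$4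
            + x$5 * y$5 + x$6 * y$6 + x$7 * y$7"

definition wedge3 :: "7 \<Rightarrow> 7 \<Rightarrow> 7 \<Rightarrow> real^7 \<Rightarrow> real^7 \<Rightarrow> real^7 \<Rightarrow> real" where
  "wedge3 i j k x y z =
     det (vector [vector [x$i, x$j, x$k], vector [y$i, y$j, y$k], vector [z$i, z$j, z$k]]
          :: real^3^3)"

definition phi0 :: "real^7 \<Rightarrow> real^7 \<Rightarrow> real^7 \<Rightarrow> real" where
  "phi0 x y z =
     - wedge3 1 2 7 x y z - wedge3 1 3 5 x y z + wedge3 1 4 6 x y z + wedge3 2 3 6 x y z
     + wedge3 2 4 5 x y z - wedge3 3 4 7 x y z + wedge3 5 6 7 x y z"


section \<open>\<open>G\<^sub>2\<^sup>*\<close> structures\<close>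

definition smooth_3form :: "'m chart set \<Rightarrow> 'm form3 \<Rightarrow> bool" where
  "smooth_3form A \<omega> \<longleftrightarrow>
     (\<forall>p. \<forall>u\<in>tangent_space A p. \<forall>v\<in>tangent_space A p. \<forall>w\<in>tangent_space A p.
        (\<forall>u'\<in>tangent_space A p. \<omega> p (tadd u u') v w = \<omega> p u v w + \<omega> p u' v w) \<and>
        (\<forall>a. \<omega> p (tscale a u) v w = a * \<omega> p u v w) \<and>
        \<omega> p v u w = - \<omega> p u v w \<and> \<omega> p u w v = - \<omega> p u v w) \<and>
     (\<forall>X\<in>vector_fields A. \<forall>Y\<in>vector_fields A. \<forall>Z\<in>vector_fields A.
        (\<lambda>p. \<omega> p (X p) (Y p) (Z p)) \<in> smooth_functions A)"

definition model_iso ::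
  "'m chart set \<Rightarrow> 'm form3 \<Rightarrow> 'm \<Rightarrow> ('m tangent \<Rightarrow> real^7) \<Rightarrow> bool" where
  "model_iso A \<omega> p L \<longleftrightarrow>
     bij_betw L (tangent_space A p) UNIV \<and>
     (\<forall>u\<in>tangent_space A p. \<forall>v\<in>tangent_space A p. L (tadd u v) = L u + L v) \<and>
     (\<forall>u\<in>tangent_space A p. \<forall>a. L (tscale a u) = a *\<^sub>R L u) \<and>
     (\<forall>u\<in>tangent_space A p. \<forall>v\<in>tangent_space A p. \<forall>w\<in>tangent_space A p.
        \<omega> p u v w = phi0 (L u) (L v) (L w))"

definition G2star_structure :: "'m chart set \<Rightarrow> 'm form3 \<Rightarrow> bool" where
  "G2star_structure A \<omega> \<longleftrightarrow> smooth_3form A \<omega> \<and> (\<forall>p. \<exists>L. model_iso A \<omega> p L)"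

text \<open>The choice of the isomorphism is immaterial, because the stabiliser of \<open>phi0\<close> preserves
  \<open>g0\<close>.\<close>

definition g43 :: "'m chart set \<Rightarrow> 'm form3 \<Rightarrow> 'm form2" where
  "g43 A \<omega> p u v = (let L = (SOME L. model_iso A \<omega> p L) in g0 (L u) (L v))"

definition cross :: "'m chart set \<Rightarrow> 'm form3 \<Rightarrow> 'm \<Rightarrow> 'm tangent \<Rightarrow> 'm tangent \<Rightarrow> 'm tangent" where
  "cross A \<omega> p u v =
     (THE w. w \<in> tangent_space A p \<and> (\<forall>z\<in>tangent_space A p. \<omega> p u v z = g43 A \<omega> p w z))"


section \<open>The induced almost paracontact metric structure\<close>

definition pc_metric :: "'m chart set \<Rightarrow> 'm form3 \<Rightarrow> 'm form2" where
  "pc_metric A \<omega> p u v = - g43 A \<omega> p u v"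

definition pc_endo :: "'m chart set \<Rightarrow> 'm form3 \<Rightarrow> 'm vfield \<Rightarrow> 'm vfield \<Rightarrow> 'm vfield" where
  "pc_endo A \<omega> \<xi> X = (\<lambda>p. cross A \<omega> p (\<xi> p) (X p))"

definition pc_eta :: "'m chart set \<Rightarrow> 'm form3 \<Rightarrow> 'm vfield \<Rightarrow> 'm vfield \<Rightarrow> 'm \<Rightarrow> real" where
  "pc_eta A \<omega> \<xi> X = (\<lambda>p. pc_metric A \<omega> p (\<xi> p) (X p))"

definition fundamental_form :: "'m chart set \<Rightarrow> 'm form3 \<Rightarrow> 'm vfield \<Rightarrow> 'm form2" where
  "fundamental_form A \<omega> \<xi> p u v = pc_metric A \<omega> p (cross A \<omega> p (\<xi> p) u) v"

definition pc_F ::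
  "'m chart set \<Rightarrow> 'm form3 \<Rightarrow> 'm vfield \<Rightarrow> ('m vfield \<Rightarrow> 'm vfield \<Rightarrow> 'm vfield) \<Rightarrow>
     'm vfield \<Rightarrow> 'm vfield \<Rightarrow> 'm vfield \<Rightarrow> 'm \<Rightarrow> real" where
  "pc_F A \<omega> \<xi> D = nabla_form2 D (fundamental_form A \<omega> \<xi>)"

definition F12 ::
  "'m chart set \<Rightarrow> 'm form3 \<Rightarrow> 'm vfield \<Rightarrow> ('m vfield \<Rightarrow> 'm vfield \<Rightarrow> 'm vfield) \<Rightarrow>
     'm vfield \<Rightarrow> 'm vfield \<Rightarrow> 'm vfield \<Rightarrow> 'm \<Rightarrow> real" where
  "F12 A \<omega> \<xi> D X Y Z = (\<lambda>p.
     let \<phi> = pc_endo A \<omega> \<xi>; \<eta> = pc_eta A \<omega> \<xi>; F = pc_F A \<omega> \<xi> D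
     in \<eta> X p * (\<eta> Y p * F \<xi> \<xi> (\<phi> (\<phi> Z)) p - \<eta> Z p * F \<xi> \<xi> (\<phi> (\<phi> Y)) p))"

end

theory Submission
  imports Defs
begin

text \<open>Let \<open>W = D \<xi> \<xi>\<close>. Since \<open>\<Phi>(\<xi>, -) = 0\<close> and \<open>\<phi>\<^sup>2 Z\<close> differs from \<open>Z\<close> by a multiple of \<open>\<xi>\<close>, one
  gets \<open>F(\<xi>, \<xi>, \<phi>\<^sup>2 Z) = \<omega>(\<xi>, W, Z)\<close>, so \<open>F\<^sup>1\<^sup>2\<close> vanishes if \<open>W\<close> does. Conversely, taking \<open>X = Y = \<xi>\<close> gives
  \<open>\<omega>(\<xi>, W, Z) = 0\<close> for all vector fields \<open>Z\<close>. Every tangent vector is the value of a vector field, so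
  \<open>P(\<xi>, W) = 0\<close>. As \<open>g(\<xi>, W) = 0\<close> because \<open>\<xi>\<close> has constant length, \<open>W = P(\<xi>, P(\<xi>, W)) = 0\<close>.\<close>

section \<open>Calculus of \<open>C\<^sup>k\<close> maps\<close>

text \<open>On an open set the derivative at a point depends only on nearby values, so equality on
  \<open>S\<close> passes to all iterated derivatives, whatever \<open>f\<close> and
  \<open>g\<close> are outside \<open>S\<close>.\<close>

lemma Ck_on_cong:
  assumes "open S" "\<And>x. x \<in> S \<Longrightarrow> f x = g x" "Ck_on k f S"
  shows "Ck_on k g S"
  using assms(2,3)
proof (induction k arbitrary: f g)
  case 0
  then show ?case using continuous_on_cong by force
next
  case (Suc k)
  have d: "f differentiable (at x)" if "x \<in> S" for x
    using Suc.prems(2) that assms(1) by (simp add: differentiable_on_eq_differentiable_at)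
  have g': "(g has_derivative frechet_derivative f (at x)) (at x)" if "x \<in> S" for x
    using d[OF that] has_derivative_transform_within_open[OF _ assms(1) that Suc.prems(1)]
    by (meson frechet_derivative_works)
  then have "g differentiable_on S"
    by (meson assms(1) differentiableI differentiable_on_eq_differentiable_at)
  moreover have "frechet_derivative f (at x) v = frechet_derivative g (at x) v" if "x \<in> S" for x v
    using frechet_derivative_at[OF g'[OF that]]
    by simp
  moreover have "Ck_on k (\<lambda>x. frechet_derivative g (at x) v) S" for v
    using Suc.IH[of "\<lambda>x. frechet_derivative f (at x) v" "\<lambda>x. frechet_derivative g (at x) v"]
      calculation(2) Suc.prems(2) by simp
  ultimately show ?case by simp
qed

lemma Ck_on_subset: "Ck_on k f S \<Longrightarrow> T \<subseteq> S \<Longrightarrow> Ck_on k f T"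
  by (induction k arbitrary: f) (auto intro: continuous_on_subset differentiable_on_subset)

lemma Ck_on_open_Un:
  assumes "open S" "open T" "Ck_on k f S" "Ck_on k f T"
  shows "Ck_on k f (S \<union> T)"
  using assms(3,4)
proof (induction k arbitrary: f)
  case 0
  then show ?case by (simp add: assms(1,2) continuous_on_open_Un)
next
  case (Suc k)
  then show ?case by (auto simp: assms(1,2) differentiable_on_eq_differentiable_at open_Un)
qed

text \<open>Uniqueness of the derivative allows any explicit formula \<open>f'\<close> to replace
  \<open>frechet_derivative\<close>; the closure rules below then reduce to the usual
  differentiation rules.\<close>

lemma Ck_on_SucI:
  assumes "open S" "\<And>x. x \<in> S \<Longrightarrow> (f has_derivative f' x) (at x)"
    and "\<And>v. Ck_on k (\<lambda>x. f' x v) S"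
  shows "Ck_on (Suc k) f S"
proof -
  have "f differentiable_on S"
    by (meson assms(1,2) differentiableI differentiable_on_eq_differentiable_at)
  moreover have "Ck_on k (\<lambda>x. frechet_derivative f (at x) v) S" for v
    by (rule Ck_on_cong[OF assms(1) _ assms(3)]) (simp add: frechet_derivative_at[OF assms(2), symmetric])
  ultimately show ?thesis by simp
qed

lemma Ck_on_Suc_has_derivative:
  assumes "open S" "Ck_on (Suc k) f S" "x \<in> S"
  shows "(f has_derivative frechet_derivative f (at x)) (at x)"
  using assms by (simp add: differentiable_on_eq_differentiable_at flip: frechet_derivative_works)

lemma Ck_on_SucD: "Ck_on (Suc k) f S \<Longrightarrow> Ck_on k f S"
  by (induction k arbitrary: f) (auto simp: differentiable_imp_continuous_on)

lemma Ck_on_const: "open S \<Longrightarrow> Ck_on k (\<lambda>x. c) S"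
proof (induction k arbitrary: c)
  case (Suc k)
  then show ?case by (intro Ck_on_SucI[where f' = "\<lambda>x v. 0"]) auto
qed auto

lemma Ck_on_bounded_linear:
  assumes "bounded_linear l" "open S" "Ck_on k f S"
  shows "Ck_on k (\<lambda>x. l (f x)) S"
  using assms(3)
proof (induction k arbitrary: f)
  case 0
  then show ?case using bounded_linear.continuous_on[OF assms(1)] by simp
next
  case (Suc k)
  show ?case
  proof (rule Ck_on_SucI[OF \<open>open S\<close>])
    show "((\<lambda>x. l (f x)) has_derivative (\<lambda>v. l (frechet_derivative f (at x) v))) (at x)"
      if "x \<in> S" for x
      using bounded_linear.has_derivative[OF assms(1) Ck_on_Suc_has_derivative[OF \<open>open S\<close> Suc.prems that]] .
    show "Ck_on k (\<lambda>x. l (frechet_derivative f (at x) v)) S" for v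
      using Suc.IH Suc.prems by simp
  qed
qed

lemma Ck_on_id: "open S \<Longrightarrow> Ck_on k (\<lambda>x. x) S"
proof (cases k)
  case (Suc k)
  then show "open S \<Longrightarrow> ?thesis"
    by (auto intro!: Ck_on_SucI[where f' = "\<lambda>x v. v"] Ck_on_const simp del: Ck_on.simps(2))
qed (simp add: continuous_on_id)

lemma Ck_on_add:
  assumes "open S" "Ck_on k f S" "Ck_on k g S"
  shows "Ck_on k (\<lambda>x. f x + g x) S"
  using assms(2,3)
proof (induction k arbitrary: f g)
  case 0
  then show ?case by (simp add: continuous_on_add)
next
  case (Suc k)
  show ?case
  proof (rule Ck_on_SucI[OF \<open>open S\<close>])
    show "((\<lambda>x. f x + g x) has_derivative
        (\<lambda>v. frechet_derivative f (at x) v + frechet_derivative g (at x) v)) (at x)" if "x \<in> S" for x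
      using Ck_on_Suc_has_derivative[OF \<open>open S\<close> _ that] Suc.prems
      by (intro has_derivative_add) blast+
    show "Ck_on k (\<lambda>x. frechet_derivative f (at x) v + frechet_derivative g (at x) v) S" for v
      using Suc by simp
  qed
qed

lemma Ck_on_sum:
  assumes "open S" "\<And>i. i \<in> I \<Longrightarrow> Ck_on k (f i) S"
  shows "Ck_on k (\<lambda>x. \<Sum>i\<in>I. f i x) S"
  using assms(2)
  by (induction I rule: infinite_finite_induct) (auto intro: Ck_on_const Ck_on_add assms(1))

lemma Ck_on_mult:
  fixes f g :: "'a::euclidean_space \<Rightarrow> real"
  assumes "open S" "Ck_on k f S" "Ck_on k g S"
  shows "Ck_on k (\<lambda>x. f x * g x) S"
  using assms(2,3)
proof (induction k arbitrary: f g)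
  case 0
  then show ?case by (simp add: continuous_on_mult)
next
  case (Suc k)
  show ?case
  proof (rule Ck_on_SucI[OF \<open>open S\<close>])
    show "((\<lambda>x. f x * g x) has_derivative
        (\<lambda>v. f x * frechet_derivative g (at x) v + frechet_derivative f (at x) v * g x)) (at x)"
      if "x \<in> S" for x
      using Ck_on_Suc_has_derivative[OF \<open>open S\<close> _ that] Suc.prems
      by (intro has_derivative_mult) blast+
    show "Ck_on k (\<lambda>x. f x * frechet_derivative g (at x) v + frechet_derivative f (at x) v * g x) S" for v
      using Suc Ck_on_SucD[OF Suc.prems(1)] Ck_on_SucD[OF Suc.prems(2)]
      by (intro Ck_on_add \<open>open S\<close> Suc.IH) simp_all
  qed
qed

text \<open>Induction on \<open>k\<close> by the chain rule, with \<open>g\<close> fixed and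
  \<open>f\<close> varying over its own directional derivatives.\<close>

lemma Ck_on_compose:
  fixes f :: "'b::euclidean_space \<Rightarrow> real" and g :: "'a::euclidean_space \<Rightarrow> 'b"
  assumes "open S" "open T" "g ` S \<subseteq> T" "Ck_on k g S" "Ck_on k f T"
  shows "Ck_on k (\<lambda>x. f (g x)) S"
  using assms(4,5)
proof (induction k arbitrary: f)
  case 0
  then show ?case using assms(3) by (auto intro: continuous_on_compose2)
next
  case (Suc k)
  let ?g' = "\<lambda>x. frechet_derivative g (at x)" and ?f' = "\<lambda>y. frechet_derivative f (at y)"
  have g': "(g has_derivative ?g' x) (at x)" if "x \<in> S" for x
    using Ck_on_Suc_has_derivative[OF \<open>open S\<close> Suc.prems(1) that] .
  have f': "(f has_derivative ?f' y) (at y)" if "y \<in> T" for y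
    using Ck_on_Suc_has_derivative[OF \<open>open T\<close> Suc.prems(2) that] .
  show ?case
  proof (rule Ck_on_SucI[OF \<open>open S\<close>])
    fix x assume x: "x \<in> S"
    then have gx: "g x \<in> T" using assms(3) by blast
    have "((\<lambda>x. f (g x)) has_derivative (\<lambda>v. ?f' (g x) (?g' x v))) (at x)"
      using has_derivative_compose[OF g'[OF x] f'[OF gx]] .
    \<comment> \<open>\<open>Ck_on\<close> controls derivatives of \<open>f\<close> only in
      directions independent of the point, but \<open>?g' x v\<close> moves with \<open>x\<close>.
      Expanding it in the basis leaves fixed directions with real coefficients.\<close>
    moreover have "?f' (g x) (?g' x v) = (\<Sum>b\<in>Basis. (?g' x v \<bullet> b) * ?f' (g x) b)" for v
    proof -
      have "linear (?f' (g x))" using f'[OF gx] by (simp add: has_derivative_linear)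
      then have "?f' (g x) (\<Sum>b\<in>Basis. (?g' x v \<bullet> b) *\<^sub>R b) = (\<Sum>b\<in>Basis. (?g' x v \<bullet> b) * ?f' (g x) b)"
        by (simp add: linear_sum linear_scale)
      then show ?thesis by (simp add: euclidean_representation)
    qed
    ultimately show "((\<lambda>x. f (g x)) has_derivative
        (\<lambda>v. \<Sum>b\<in>Basis. (?g' x v \<bullet> b) * ?f' (g x) b)) (at x)" by simp
  next
    fix v
    show "Ck_on k (\<lambda>x. \<Sum>b\<in>Basis. (?g' x v \<bullet> b) * ?f' (g x) b) S"
      using Suc.prems Ck_on_SucD[OF Suc.prems(1)]
      by (intro Ck_on_sum Ck_on_mult Ck_on_bounded_linear[where l = "\<lambda>y. y \<bullet> _"]
          Suc.IH[where f = "\<lambda>y. ?f' y _"] \<open>open S\<close> bounded_linear_inner_left) simp_all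
  qed
qed

section \<open>A bump function\<close>

text \<open>The factor \<open>inverse t ^ n\<close> makes the span of the family closed under differentiation.\<close>

definition flat :: "nat \<Rightarrow> real \<Rightarrow> real" where
  "flat n t = (if t > 0 then exp (- inverse t) * inverse t ^ n else 0)"

text \<open>From the right, substituting s = 1/t gives s^n / exp s with s tending to infinity; from
  the left the function is constantly 0.\<close>

lemma flat_tendsto_0: "(flat n \<longlongrightarrow> 0) (at 0)"
proof -
  have "((\<lambda>s::real. s ^ n / exp s) \<longlongrightarrow> 0) at_top"
    by (rule tendsto_power_div_exp_0)
  then have "((\<lambda>t. inverse t ^ n / exp (inverse t)) \<longlongrightarrow> 0) (at_right (0::real))"
    by (rule filterlim_compose[OF _ filterlim_inverse_at_top_right])
  then have "(flat n \<longlongrightarrow> 0) (at_right 0)"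
    by (rule Lim_transform_eventually) (auto simp: flat_def eventually_at_filter exp_minus field_simps)
  moreover have "(flat n \<longlongrightarrow> 0) (at_left 0)"
    by (rule tendsto_eventually) (auto simp: flat_def eventually_at_filter)
  ultimately show ?thesis by (simp add: filterlim_split_at)
qed

lemma flat_has_real_derivative:
  "(flat n has_real_derivative flat (n + 2) t - of_nat n * flat (n + 1) t) (at t)"
proof -
  consider "t > 0" | "t < 0" | "t = 0" by linarith
  then show ?thesis
  proof cases
    case 1
    have "((\<lambda>t. exp (- inverse t) * inverse t ^ n) has_real_derivative
        exp (- inverse t) * inverse t ^ (n + 2) - of_nat n * (exp (- inverse t) * inverse t ^ (n + 1))) (at t)"
    \<comment> \<open>Splitting off \<open>n = 0\<close> avoids the truncated exponent
      \<open>n - 1\<close> of the power rule.\<close>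
    proof (cases n)
      case 0
      then show ?thesis using 1 
        by (auto intro!: derivative_eq_intros simp: power2_eq_square)
    next
      case (Suc m)
      show ?thesis unfolding Suc
        by (rule derivative_eq_intros refl | use 1 in \<open>simp add: algebra_simps power2_eq_square\<close>)+
    qed
    then show ?thesis using 1
      by (intro has_field_derivative_transform_within_open[where S = "{0<..}" and g = "flat n"])
        (auto simp: flat_def)
  next
    case 2
    have "((\<lambda>t. 0) has_real_derivative flat (n + 2) t - of_nat n * flat (n + 1) t) (at t)"
      using 2 by (simp add: flat_def)
    then show ?thesis
      by (rule has_field_derivative_transform_within_open[where S = "{..<0}"]) (use 2 in \<open>auto simp: flat_def\<close>)
  next
    case 3
    \<comment> \<open>Dividing by \<open>h\<close> adds one factor \<open>inverse h\<close>, so the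
      difference quotient at 0 is again a member of the family.\<close>
    have "(\<lambda>h. (flat n (0 + h) - flat n 0) / h) = flat (n + 1)"
      by (auto simp: flat_def divide_inverse)
    then have "(flat n has_real_derivative 0) (at 0)"
      unfolding DERIV_def using flat_tendsto_0[of "n + 1"] by simp
    then show ?thesis using 3 by (simp add: flat_def)
  qed
qed

lemma Ck_on_flat: "Ck_on k (flat n) UNIV"
proof (induction k arbitrary: n)
  case 0
  then show ?case
    using DERIV_isCont[OF flat_has_real_derivative[of n]] by (simp add: continuous_at_imp_continuous_on)
next
  case (Suc k)
  show ?case
  proof (rule Ck_on_SucI)
    show "(flat n has_derivative (\<lambda>v. v * (flat (n + 2) t + (- of_nat n) * flat (n + 1) t))) (at t)" for t
      using flat_has_real_derivative[of n t] by (simp add: has_field_derivative_def mult.commute[of _ "_ - _"])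
    show "Ck_on k (\<lambda>t. v * (flat (n + 2) t + (- of_nat n) * flat (n + 1) t)) UNIV" for v
      by (intro Ck_on_mult Ck_on_add Ck_on_const Suc open_UNIV)
  qed auto
qed

section \<open>Vector fields through a given tangent vector\<close>

lemma tangent_spaceD:
  assumes "v \<in> tangent_space A p" "f \<in> smooth_functions A"
  shows "h \<in> smooth_functions A \<Longrightarrow> v (\<lambda>q. f q + h q) = v f + v h"
    and "h \<in> smooth_functions A \<Longrightarrow> v (\<lambda>q. f q * h q) = f p * v h + h p * v f"
    and "v (\<lambda>q. a * f q) = a * v f"
  using assms unfolding tangent_space_def by auto

lemma tangent_space_tadd:
  assumes "u \<in> tangent_space A p" "v \<in> tangent_space A p"
  shows "tadd u v \<in> tangent_space A p"
  using assms unfolding tangent_space_def tadd_def by (simp add: algebra_simps)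

lemma tangent_space_tscale: "u \<in> tangent_space A p \<Longrightarrow> tscale a u \<in> tangent_space A p"
  unfolding tangent_space_def tscale_def by (simp add: algebra_simps)

section \<open>Charts, smooth functions and cut-off coordinate fields on the manifold\<close>

locale smooth_manifold =
  fixes A :: "('m::{t2_space, second_countable_topology}) chart set"
  assumes manifold: "smooth_oriented_manifold A"
begin

abbreviation inv_chart :: "'m chart \<Rightarrow> real^7 \<Rightarrow> 'm" where
  "inv_chart c \<equiv> inv_into (fst c) (snd c)"

lemma chart:
  assumes "c \<in> A"
  shows open_chart: "open (fst c)"
    and open_chart_image: "open (snd c ` fst c)"
    and inj_chart: "inj_on (snd c) (fst c)"
    and continuous_inv_chart: "continuous_on (snd c ` fst c) (inv_chart c)"
proof -
  obtain y where o: "open (fst c)" "open (snd c ` fst c)"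
    and h: "homeomorphism (fst c) (snd c ` fst c) (snd c) y"
    using manifold assms unfolding smooth_oriented_manifold_def is_chart_def by force
  show "open (fst c)" "open (snd c ` fst c)" by fact+
  show inj: "inj_on (snd c) (fst c)" by (rule inj_on_inverseI[where g = y]) (use h in \<open>simp add: homeomorphism_def\<close>)
  \<comment> \<open>The inverse \<open>y\<close> from the homeomorphism agrees with
    \<open>inv_into\<close> on the image, which transfers continuity.\<close>
  have "inv_chart c z = y z" if "z \<in> snd c ` fst c" for z
    using that inj h by (auto simp: homeomorphism_apply1)
  then show "continuous_on (snd c ` fst c) (inv_chart c)"
    using homeomorphism_cont2[OF h] by (metis (no_types, lifting) continuous_on_cong)
qed

lemma smooth_functionsD:
  "f \<in> smooth_functions A \<Longrightarrow> c \<in> A \<Longrightarrow> smooth_on (\<lambda>y. f (inv_chart c y)) (snd c ` fst c)"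
  by (auto simp: smooth_functions_def o_def)

lemma smooth_functionsI:
  "(\<And>c k. c \<in> A \<Longrightarrow> Ck_on k (\<lambda>y. f (inv_chart c y)) (snd c ` fst c)) \<Longrightarrow> f \<in> smooth_functions A"
  by (auto simp: smooth_functions_def smooth_on_def o_def)

lemma smooth_functions_const: "(\<lambda>q. a) \<in> smooth_functions A"
  by (intro smooth_functionsI Ck_on_const open_chart_image)

lemma smooth_functions_add:
  "f \<in> smooth_functions A \<Longrightarrow> h \<in> smooth_functions A \<Longrightarrow> (\<lambda>q. f q + h q) \<in> smooth_functions A"
  using smooth_functionsD
  by (intro smooth_functionsI Ck_on_add open_chart_image) (auto simp: smooth_on_def)

lemma smooth_functions_mult:
  "f \<in> smooth_functions A \<Longrightarrow> h \<in> smooth_functions A \<Longrightarrow> (\<lambda>q. f q * h q) \<in> smooth_functions A"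
  using smooth_functionsD
  by (intro smooth_functionsI Ck_on_mult open_chart_image) (auto simp: smooth_on_def)

lemma smooth_functions_extend_by_zero:
  assumes c: "c \<in> A" and h: "smooth_on h (snd c ` fst c)"
    and K: "compact K" "K \<subseteq> snd c ` fst c" "\<And>y. y \<notin> K \<Longrightarrow> h y = 0"
  shows "(\<lambda>q. if q \<in> fst c then h (snd c q) else 0) \<in> smooth_functions A"
proof (rule smooth_functionsI)
  fix d k assume d: "d \<in> A"
  let ?V = "snd d ` fst d" and ?F = "\<lambda>y. if inv_chart d y \<in> fst c then h (snd c (inv_chart d y)) else 0"
  define V\<^sub>1 where "V\<^sub>1 = ?V \<inter> inv_chart d -` fst c"
  define V\<^sub>2 where "V\<^sub>2 = ?V \<inter> inv_chart d -` (- inv_chart c ` K)"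
  have "compact (inv_chart c ` K)"
    using K continuous_inv_chart[OF c] by (meson compact_continuous_image continuous_on_subset)
  then have "open (- inv_chart c ` K)" by (simp add: compact_imp_closed open_Compl)
  then have o: "open V\<^sub>1" "open V\<^sub>2"
    unfolding V\<^sub>1_def V\<^sub>2_def
    using continuous_open_preimage[OF continuous_inv_chart[OF d] open_chart_image[OF d]] open_chart[OF c]
    by blast+
  have inv_c: "inv_chart c (snd c q) = q" if "q \<in> fst c" for q
    using that inj_chart[OF c] by simp
  have V: "V\<^sub>1 \<union> V\<^sub>2 = ?V"
    unfolding V\<^sub>1_def V\<^sub>2_def using K(2) inv_into_into[of _ "snd c" "fst c"] by fastforce
  have "V\<^sub>1 = overlap d c"
    unfolding V\<^sub>1_def overlap_def using inj_chart[OF d] by (auto simp: image_iff) 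
  then have t: "Ck_on k (transition d c) V\<^sub>1"
    using manifold c d unfolding smooth_oriented_manifold_def smooth_on_def by blast
  have "Ck_on k (\<lambda>y. h (transition d c y)) V\<^sub>1"
    using h by (intro Ck_on_compose[OF o(1) open_chart_image[OF c] _ t])
      (auto simp: V\<^sub>1_def transition_def smooth_on_def)
  then have 1: "Ck_on k ?F V\<^sub>1"
    by (rule Ck_on_cong[OF o(1), rotated]) (auto simp: V\<^sub>1_def transition_def)
  have "?F y = 0" if "y \<in> V\<^sub>2" for y
    using that K(3) inv_c unfolding V\<^sub>2_def by force
  then have 2: "Ck_on k ?F V\<^sub>2"
    by (intro Ck_on_cong[OF o(2) _ Ck_on_const[OF o(2), of k 0]]) auto
  show "Ck_on k ?F ?V"
    using Ck_on_open_Un[OF o 1 2] unfolding V .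
qed

text \<open>Compose \<open>flat 0\<close> with r^2 - |y - a|^2, which is positive at the centre
  \<open>a\<close> and negative off the closed ball of radius \<open>r\<close>.\<close>

lemma bump_function:
  assumes "c \<in> A" "a \<in> snd c ` fst c"
  obtains \<beta> K where "\<And>k. Ck_on k \<beta> UNIV" "\<beta> a \<noteq> (0 :: real)" "compact K" "K \<subseteq> snd c ` fst c"
    "\<And>y. y \<notin> K \<Longrightarrow> \<beta> y = 0"
proof -
  obtain r where r: "r > 0" "cball a r \<subseteq> snd c ` fst c"
    using open_chart_image[OF assms(1)] assms(2) open_contains_cball by blast
  \<comment> \<open>The polynomial is spelled out with sums and products only, to match the closure
    rules for \<open>Ck_on\<close>.\<close>
  let ?q = "\<lambda>y :: real^7. r\<^sup>2 + (\<Sum>b\<in>Basis. - 1 * (((y + - a) \<bullet> b) * ((y + - a) \<bullet> b)))"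
  have q: "?q y = r\<^sup>2 - (dist a y)\<^sup>2" for y
  proof -
    have "(dist a y)\<^sup>2 = (y - a) \<bullet> (y - a)"
      by (subst dist_commute) (simp add: dist_norm power2_norm_eq_inner)
    also have "\<dots> = (\<Sum>b\<in>Basis. ((y - a) \<bullet> b) * ((y - a) \<bullet> b))"
      by (rule euclidean_inner)
    finally show ?thesis by (simp add: sum_negf)
  qed
  show ?thesis
  proof (rule that)
    have "Ck_on k ?q UNIV" for k
      by (intro Ck_on_add Ck_on_const Ck_on_sum Ck_on_mult Ck_on_id
          Ck_on_bounded_linear[where l = "\<lambda>y. y \<bullet> _"] bounded_linear_inner_left open_UNIV)
    then show "Ck_on k (\<lambda>y. flat 0 (?q y)) UNIV" for k
      by (intro Ck_on_compose[OF _ _ _ _ Ck_on_flat]) auto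
    show "flat 0 (?q a) \<noteq> 0" unfolding q using r(1) by (simp add: flat_def)
    show "compact (cball a r)" by simp
    show "cball a r \<subseteq> snd c ` fst c" by fact
    show "flat 0 (?q y) = 0" if "y \<notin> cball a r" for y
    proof -
      have "r\<^sup>2 < (dist a y)\<^sup>2" using that r(1) by (intro power_strict_mono) auto
      then show ?thesis unfolding q by (simp add: flat_def)
    qed
  qed
qed

text \<open>The coordinate derivation in direction \<open>e\<close>, cut off by
  \<open>\<beta>\<close>. The value 0 on non-smooth \<open>f\<close> follows the normalisation in
  \<open>tangent_space\<close>.\<close>

definition partial_field :: "'m chart \<Rightarrow> (real^7 \<Rightarrow> real) \<Rightarrow> real^7 \<Rightarrow> 'm vfield" where
  "partial_field c \<beta> e q f = (if q \<in> fst c \<and> f \<in> smooth_functions A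
     then \<beta> (snd c q) * frechet_derivative (\<lambda>y. f (inv_chart c y)) (at (snd c q)) e else 0)"

lemma partial_field_tangent:
  assumes c: "c \<in> A"
  shows "partial_field c \<beta> e q \<in> tangent_space A q"
proof (cases "q \<in> fst c")
  case True
  let ?a = "snd c q" and ?d = "\<lambda>f. frechet_derivative (\<lambda>y. f (inv_chart c y)) (at (snd c q))"
  have a: "?a \<in> snd c ` fst c" and q: "inv_chart c ?a = q"
    using True inj_chart[OF c] by auto
  have d: "((\<lambda>y. f (inv_chart c y)) has_derivative ?d f) (at ?a)" if "f \<in> smooth_functions A" for f
    using smooth_functionsD[OF that c] a
    by (intro Ck_on_Suc_has_derivative[OF open_chart_image[OF c], of 0]) (auto simp only: smooth_on_def)
  have "?d (\<lambda>q. f q + h q) e = ?d f e + ?d h e"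
    "?d (\<lambda>q. f q * h q) e = f q * ?d h e + ?d f e * h q"
    if "f \<in> smooth_functions A" "h \<in> smooth_functions A" for f h
    using frechet_derivative_at[OF has_derivative_add[OF d[OF that(1)] d[OF that(2)]], symmetric]
      frechet_derivative_at[OF has_derivative_mult[OF d[OF that(1)] d[OF that(2)]], symmetric] q
    by simp_all
  moreover have "?d (\<lambda>q. b * f q) e = b * ?d f e" if "f \<in> smooth_functions A" for f b
    using frechet_derivative_at[OF has_derivative_mult_right[OF d[OF that]], symmetric] by simp
  ultimately show ?thesis
    using True smooth_functions_add smooth_functions_mult[OF smooth_functions_const] smooth_functions_mult
    by (auto simp: tangent_space_def partial_field_def algebra_simps)
next
  case False
  then show ?thesis by (simp add: tangent_space_def partial_field_def)
qed

text \<open>Applied to a smooth function, the field gives \<open>\<beta>\<close> times a coordinate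
  derivative; this is supported in \<open>K\<close>, so it extends smoothly by zero.\<close>

lemma partial_field_vector_field:
  assumes c: "c \<in> A" and \<beta>: "\<And>k. Ck_on k \<beta> UNIV"
    and K: "compact K" "K \<subseteq> snd c ` fst c" "\<And>y. y \<notin> K \<Longrightarrow> \<beta> y = 0"
  shows "partial_field c \<beta> e \<in> vector_fields A"
proof -
  have "deriv_along (partial_field c \<beta> e) f \<in> smooth_functions A" if f: "f \<in> smooth_functions A" for f
  proof -
    let ?h = "\<lambda>y. \<beta> y * frechet_derivative (\<lambda>y. f (inv_chart c y)) (at y) e"
    \<comment> \<open>One order of differentiability is spent on the derivative in direction
      \<open>e\<close>.\<close>
    have "Ck_on (Suc k) (\<lambda>y. f (inv_chart c y)) (snd c ` fst c)" for k
      using smooth_functionsD[OF f c] by (simp only: smooth_on_def)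
    then have "smooth_on ?h (snd c ` fst c)"
      unfolding smooth_on_def using \<beta>
      by (auto intro!: Ck_on_mult open_chart_image c intro: Ck_on_subset)
    from smooth_functions_extend_by_zero[OF c this K(1,2)] K(3) f
    show ?thesis by (simp add: deriv_along_def partial_field_def cong: if_cong)
  qed
  then show ?thesis using partial_field_tangent[OF c] by (simp add: vector_fields_def)
qed

lemma vector_fields_vadd:
  "X \<in> vector_fields A \<Longrightarrow> Y \<in> vector_fields A \<Longrightarrow> vadd X Y \<in> vector_fields A"
  using smooth_functions_add
  by (auto simp: vector_fields_def vadd_def tangent_space_tadd deriv_along_def)
    (simp add: tadd_def)

lemma vector_fields_vscale:
  "f \<in> smooth_functions A \<Longrightarrow> X \<in> vector_fields A \<Longrightarrow> vscale f X \<in> vector_fields A"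
  using smooth_functions_mult
  by (auto simp: vector_fields_def vscale_def tangent_space_tscale deriv_along_def)
    (simp add: tscale_def)

text \<open>The Leibniz rule for 1 = 1 * 1 gives v(1) = 2 v(1); homogeneity does the rest.\<close>

lemma tangent_space_const:
  assumes v: "v \<in> tangent_space A p"
  shows "v (\<lambda>q. a) = 0"
proof -
  have "v (\<lambda>q. 1) = 0"
    using tangent_spaceD(2)[OF v smooth_functions_const smooth_functions_const, of 1 1] by simp
  then show ?thesis
    using tangent_spaceD(3)[OF v smooth_functions_const, of a 1] by simp
qed

text \<open>The cut-off coordinate fields at p are, up to scaling, dual to the differentials of cut-off coordinate functions, so
  they are linearly independent; since the tangent space is known to be 7-dimensional,
  they span it. Hence derivations need not be identified with partial derivatives.\<close>

lemma vector_field_through: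
  fixes L :: "'m tangent \<Rightarrow> real^7"
  assumes L: "bij_betw L (tangent_space A p) UNIV"
    and L_add: "\<And>u v. u \<in> tangent_space A p \<Longrightarrow> v \<in> tangent_space A p \<Longrightarrow> L (tadd u v) = L u + L v"
    and L_scale: "\<And>u a. u \<in> tangent_space A p \<Longrightarrow> L (tscale a u) = a *\<^sub>R L u"
    and u: "u \<in> tangent_space A p"
  obtains Z where "Z \<in> vector_fields A" "Z p = u"
proof -
  let ?T = "tangent_space A p"
  obtain c where c: "c \<in> A" "p \<in> fst c"
    using manifold unfolding smooth_oriented_manifold_def by blast
  define a where "a = snd c p"
  have a: "a \<in> snd c ` fst c" and inv_a: "inv_chart c a = p"
    using c inj_chart[OF c(1)] by (auto simp: a_def)
  obtain \<beta> :: "real^7 \<Rightarrow> real" and K where \<beta>: "\<And>k. Ck_on k \<beta> UNIV" "\<beta> a \<noteq> 0"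
    and K: "compact K" "K \<subseteq> snd c ` fst c" "\<And>y. y \<notin> K \<Longrightarrow> \<beta> y = 0"
    using bump_function[OF c(1) a] by blast
  define X where "X i = partial_field c \<beta> (axis i 1)" for i
  have X: "X i \<in> vector_fields A" for i
    unfolding X_def by (rule partial_field_vector_field[OF c(1) \<beta>(1) K])
  define h where "h j y = \<beta> y * ((y + - a) \<bullet> axis j 1)" for j y
  define f where "f j q = (if q \<in> fst c then h j (snd c q) else 0)" for j q
  have h: "smooth_on (h j) (snd c ` fst c)" for j
    unfolding h_def smooth_on_def
    by (intro allI Ck_on_mult Ck_on_add Ck_on_id Ck_on_const Ck_on_subset[OF \<beta>(1)] open_chart_image c
        Ck_on_bounded_linear[where l = "\<lambda>y. y \<bullet> _"] bounded_linear_inner_left subset_UNIV)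
  have f: "f j \<in> smooth_functions A" for j
    unfolding f_def
    by (rule smooth_functions_extend_by_zero[OF c(1) h K(1,2)]) (simp add: h_def K(3))
  have "((\<lambda>y. f j (inv_chart c y)) has_derivative (\<lambda>v. \<beta> a * (v \<bullet> axis j 1))) (at a)" for j
  proof -
    have "(\<beta> has_derivative frechet_derivative \<beta> (at a)) (at a)"
      by (rule Ck_on_Suc_has_derivative[OF open_UNIV \<beta>(1)]) simp
    \<comment> \<open>The term containing the derivative of \<open>\<beta>\<close> drops out, since
      its other factor vanishes at \<open>a\<close>.\<close>
    then have "(h j has_derivative (\<lambda>v. \<beta> a * (v \<bullet> axis j 1))) (at a)"
      unfolding h_def by (auto intro!: derivative_eq_intros)
    then show ?thesis
      by (rule has_derivative_transform_within_open[OF _ open_chart_image[OF c(1)] a])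
        (use inj_chart[OF c(1)] in \<open>auto simp: f_def\<close>)
  qed
  note df = frechet_derivative_at[OF this, symmetric]
  have Xf: "X i p (f j) = \<beta> a * \<beta> a * (if i = j then 1 else 0)" for i j
    using c(2) f by (simp add: X_def partial_field_def df inner_axis_axis flip: a_def)
  define L' where "L' = inv_into ?T L"
  have L'_T: "L' z \<in> ?T" and LL': "L (L' z) = z" for z
    using bij_betw_inv_into_right[OF L] inv_into_into[of z L ?T] bij_betw_imp_surj_on[OF L]
    by (auto simp: L'_def)
  have L'L: "L' (L v) = v" if "v \<in> ?T" for v
    using that bij_betw_inv_into_left[OF L] by (simp add: L'_def)
  have L'_add: "L' (y + z) = tadd (L' y) (L' z)" for y z
    using L'L[OF tangent_space_tadd[OF L'_T[of y] L'_T[of z]]] L'_T L_add LL' by simp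
  have L'_scale: "L' (b *\<^sub>R z) = tscale b (L' z)" for b z
    using L'L[OF tangent_space_tscale[OF L'_T[of z]]] L'_T L_scale LL' by simp
  \<comment> \<open>\<open>G\<close> records the values of a tangent vector on the seven functions
    \<open>f j\<close>. As an endomorphism of \<open>real^7\<close> it is injective once it is
    surjective.\<close>
  define G where "G z = (\<chi> j. L' z (f j))" for z
  have G: "linear G"
    by (rule linearI) (simp_all add: G_def vec_eq_iff L'_add L'_scale tadd_def tscale_def)
  have XT: "Z p \<in> ?T" if "Z \<in> vector_fields A" for Z
    using that by (simp add: vector_fields_def)
  have GX: "G (L (X i p)) = (\<beta> a * \<beta> a) *\<^sub>R axis i 1" for i
    by (auto simp: G_def L'L XT X Xf vec_eq_iff axis_def)
  \<comment> \<open>The values at \<open>p\<close> of global vector fields. Once \<open>G\<close>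
    maps \<open>S\<close> onto everything, its injectivity forces \<open>L u\<close> into
    \<open>S\<close>.\<close>
  define S where "S = {L (Z p) | Z. Z \<in> vector_fields A}"
  have S_add: "y + z \<in> S" if yz: "y \<in> S" "z \<in> S" for y z
  proof -
    obtain Y Z where Y: "Y \<in> vector_fields A" "y = L (Y p)" and Z: "Z \<in> vector_fields A" "z = L (Z p)"
      using yz unfolding S_def by blast
    have "vadd Y Z \<in> vector_fields A"
      by (rule vector_fields_vadd[OF Y(1) Z(1)])
    moreover have "L (vadd Y Z p) = y + z"
      using Y Z by (simp add: vadd_def L_add XT)
    ultimately show ?thesis unfolding S_def by (auto intro!: exI[of _ "vadd Y Z"])
  qed
  have S_scale: "b *\<^sub>R z \<in> S" if z: "z \<in> S" for b z
  proof -
    obtain Z where Z: "Z \<in> vector_fields A" "z = L (Z p)" using z unfolding S_def by blast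
    have "vscale (\<lambda>q. b) Z \<in> vector_fields A"
      by (rule vector_fields_vscale[OF smooth_functions_const Z(1)])
    moreover have "L (vscale (\<lambda>q. b) Z p) = b *\<^sub>R z"
      using Z by (simp add: vscale_def L_scale XT)
    ultimately show ?thesis unfolding S_def by (auto intro!: exI[of _ "vscale (\<lambda>q. b) Z"])
  qed
  have X_S: "L (X i p) \<in> S" for i
    using X unfolding S_def by blast
  have S: "subspace S"
    using S_scale[OF X_S, of 0] by (intro subspaceI S_add S_scale) simp_all
  have GS: "G ` S = UNIV"
  proof -
    have "axis i 1 \<in> G ` S" for i
    proof -
      have "G ((inverse (\<beta> a * \<beta> a)) *\<^sub>R L (X i p)) = axis i 1"
        using \<beta>(2) by (simp add: linear_scale[OF G] GX field_simps del: inverse_mult_distrib)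
      then show ?thesis by (rule image_eqI[OF sym]) (rule S_scale[OF X_S])
    qed
    then have "span (Basis :: (real^7) set) \<subseteq> G ` S"
      by (intro span_minimal linear_subspace_image[OF G S]) (auto simp: Basis_vec_def)
    then show ?thesis unfolding span_Basis by blast
  qed
  then have "surj G" by blast
  then have "inj G" using linear_surjective_imp_injective[OF G] by simp
  moreover obtain z where "z \<in> S" "G (L u) = G z"
    using GS by (metis UNIV_I imageE)
  ultimately have "L u \<in> S" by (simp add: inj_eq)
  then obtain Z where Z: "Z \<in> vector_fields A" "L u = L (Z p)" unfolding S_def by blast
  then have "Z p = u" using L'L u XT by metis
  with Z(1) show ?thesis by (rule that)
qed

end
section \<open>The model cross product\<close>

text \<open>The seven numerals are distinct, so they exhaust the type by cardinality; vector
  identities then split into coordinates.\<close>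

lemma UNIV_7: "(UNIV :: 7 set) = {1, 2, 3, 4, 5, 6, 7}"
proof (rule card_seteq[symmetric, OF finite])
  show "card (UNIV :: 7 set) \<le> card {1 :: 7, 2, 3, 4, 5, 6, 7}" by simp
qed simp

lemma vec7_eq_iff:
  fixes x y :: "real^7"
  shows "x = y \<longleftrightarrow> x$1 = y$1 \<and> x$2 = y$2 \<and> x$3 = y$3 \<and> x$4 = y$4 \<and> x$5 = y$5 \<and> x$6 = y$6 \<and> x$7 = y$7"
proof -
  have "x = y \<longleftrightarrow> (\<forall>i\<in>UNIV. x$i = y$i)" by (simp add: vec_eq_iff)
  then show ?thesis unfolding UNIV_7 by simp
qed

text \<open>The last index of \<open>phi0\<close> raised with \<open>g0\<close>: the factor
  \<open>g0 (axis i 1) (axis i 1)\<close> is the sign of the i-th basis vector.\<close>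

definition cross0 :: "real^7 \<Rightarrow> real^7 \<Rightarrow> real^7" where
  "cross0 x y = (\<chi> i. g0 (axis i 1) (axis i 1) * phi0 x y (axis i 1))"

lemmas model_simps = g0_def phi0_def wedge3_def det_3 axis_def vector_3

lemma g0_cross0: "g0 (cross0 x y) z = phi0 x y z"
  by (simp add: cross0_def model_simps) (simp add: algebra_simps)

text \<open>The double cross product identity, checked as a polynomial identity in coordinates. It
  gives both the formula for the square of the paracontact endomorphism and the recovery of
  \<open>y\<close> from \<open>cross0 x y\<close>.\<close>

lemma cross0_cross0: "cross0 x (cross0 x y) = g0 x y *\<^sub>R x - g0 x x *\<^sub>R y"
  unfolding vec7_eq_iff
  by (simp add: cross0_def model_simps) (simp add: algebra_simps)

lemma g0_nondegenerate: "(\<And>z. g0 x z = g0 y z) \<Longrightarrow> x = y"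
proof -
  assume *: "\<And>z. g0 x z = g0 y z"
  have "g0 x (axis i 1) = g0 y (axis i 1)" for i by (rule *)
  from this[of 1] this[of 2] this[of 3] this[of 4] this[of 5] this[of 6] this[of 7]
  show ?thesis unfolding vec7_eq_iff by (simp add: g0_def axis_def)
qed

lemma phi0_same: "phi0 x x z = 0"
  by (simp add: model_simps)

lemma g0_right:
  "g0 x (y + z) = g0 x y + g0 x z" "g0 x (y - z) = g0 x y - g0 x z"
  "g0 x (a *\<^sub>R y) = a * g0 x y" "g0 x 0 = 0"
  by (simp_all add: g0_def algebra_simps)

lemma g0_commute: "g0 x y = g0 y x" by (simp add: g0_def)

text \<open>For \<open>x\<close> of square -1 and \<open>y\<close> orthogonal to \<open>x\<close>, a
  second product with \<open>x\<close> turns \<open>cross0 x y\<close> back into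
  \<open>y\<close>.\<close>

lemma cross0_eq_0_imp:
  assumes "g0 x x = -1" "g0 x y = 0" "\<And>z. phi0 x y z = 0"
  shows "y = 0"
proof -
  have "cross0 x y = 0"
    by (rule g0_nondegenerate) (simp add: g0_cross0 assms(3), simp add: g0_def)
  moreover have "cross0 x 0 = 0" by (simp add: cross0_def model_simps vec_eq_iff)
  ultimately show ?thesis using cross0_cross0[of x y] assms by simp
qed

section \<open>The component on \<open>\<G>\<^sub>1\<^sub>2\<close>\<close>

lemma phi0_right:
  "phi0 x y (z + w) = phi0 x y z + phi0 x y w" "phi0 x y (z - w) = phi0 x y z - phi0 x y w"
  "phi0 x y (a *\<^sub>R z) = a * phi0 x y z"
  by (simp_all add: g0_right flip: g0_cross0)

lemma phi0_outer_eq: "phi0 x y x = 0"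
  by (simp add: model_simps)

lemma phi0_middle_zero: "phi0 x 0 z = 0"
  by (simp add: model_simps)

section \<open>Pointwise transfer of the structure to the model\<close>

locale G2star_unit_field = smooth_manifold A
  for A :: "('m::{t2_space, second_countable_topology}) chart set" +
  fixes \<omega> :: "'m form3" and \<xi> :: "'m vfield" and D :: "'m vfield \<Rightarrow> 'm vfield \<Rightarrow> 'm vfield"
  assumes G2star: "G2star_structure A \<omega>"
    and xi: "\<xi> \<in> vector_fields A"
    and xi_norm: "\<And>p. g43 A \<omega> p (\<xi> p) (\<xi> p) = -1"
    and levi_civita: "levi_civita A (pc_metric A \<omega>) D"
begin

text \<open>The same \<open>SOME\<close> term as in \<open>g43\<close>, so that the metric becomes
  \<open>g0\<close> by unfolding.\<close>

definition model :: "'m \<Rightarrow> 'm tangent \<Rightarrow> real^7" where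
  "model p = (SOME L. model_iso A \<omega> p L)"

lemma model_iso_model: "model_iso A \<omega> p (model p)"
proof -
  have "\<exists>L. model_iso A \<omega> p L" using G2star by (simp add: G2star_structure_def)
  then show ?thesis unfolding model_def by (rule someI_ex)
qed

lemma model_bij: "bij_betw (model p) (tangent_space A p) UNIV"
  using model_iso_model[of p] by (simp add: model_iso_def)

lemma model_tadd:
  "u \<in> tangent_space A p \<Longrightarrow> v \<in> tangent_space A p \<Longrightarrow> model p (tadd u v) = model p u + model p v"
  using model_iso_model[of p] by (simp add: model_iso_def)

lemma model_tscale: "u \<in> tangent_space A p \<Longrightarrow> model p (tscale a u) = a *\<^sub>R model p u"
  using model_iso_model[of p] by (simp add: model_iso_def)

lemma omega_model:
  "u \<in> tangent_space A p \<Longrightarrow> v \<in> tangent_space A p \<Longrightarrow> w \<in> tangent_space A p \<Longrightarrow>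
    \<omega> p u v w = phi0 (model p u) (model p v) (model p w)"
  using model_iso_model[of p] by (simp add: model_iso_def)

lemma g43_model: "g43 A \<omega> p u v = g0 (model p u) (model p v)"
  by (simp add: g43_def model_def Let_def)

lemma model_inject:
  "u \<in> tangent_space A p \<Longrightarrow> v \<in> tangent_space A p \<Longrightarrow> model p u = model p v \<longleftrightarrow> u = v"
  using model_bij[of p] by (meson bij_betw_imp_inj_on inj_on_eq_iff)

lemma model_surj: obtains u where "u \<in> tangent_space A p" "model p u = z"
  using model_bij[of p] by (metis UNIV_I bij_betw_imp_surj_on imageE)

lemma tzero_tangent: "tzero \<in> tangent_space A p"
  by (simp add: tangent_space_def tzero_def)

lemma model_tzero: "model p tzero = 0"
  using model_tscale[OF tzero_tangent, of p 0] by (simp add: tscale_def tzero_def)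

lemma vector_field_tangent: "X \<in> vector_fields A \<Longrightarrow> X p \<in> tangent_space A p"
  by (simp add: vector_fields_def)

text \<open>The definite description is justified by pulling \<open>cross0\<close> back along the
  bijection \<open>model p\<close> (existence) and by nondegeneracy of \<open>g0\<close>
  (uniqueness).\<close>

lemma cross_model:
  assumes u: "u \<in> tangent_space A p" and v: "v \<in> tangent_space A p"
  shows cross_tangent: "cross A \<omega> p u v \<in> tangent_space A p"
    and model_cross: "model p (cross A \<omega> p u v) = cross0 (model p u) (model p v)"
proof -
  obtain w where w: "w \<in> tangent_space A p" "model p w = cross0 (model p u) (model p v)"
    by (rule model_surj)
  have "cross A \<omega> p u v = w"
    unfolding cross_def
  proof (rule the_equality)
    show "w \<in> tangent_space A p \<and> (\<forall>z\<in>tangent_space A p. \<omega> p u v z = g43 A \<omega> p w z)"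
      using w u v by (simp add: omega_model g43_model g0_cross0)
  next
    fix w' assume w': "w' \<in> tangent_space A p \<and> (\<forall>z\<in>tangent_space A p. \<omega> p u v z = g43 A \<omega> p w' z)"
    have "g0 (model p w') z = g0 (model p w) z" for z
    proof -
      obtain z' where z': "z' \<in> tangent_space A p" "model p z' = z" by (rule model_surj)
      then have "\<omega> p u v z' = g43 A \<omega> p w' z'" using w' by blast
      then show ?thesis using z' w(2) u v by (simp add: omega_model g43_model g0_cross0)
    qed
    then show "w' = w" using g0_nondegenerate model_inject w' w(1) by blast
  qed
  with w show "cross A \<omega> p u v \<in> tangent_space A p"
    "model p (cross A \<omega> p u v) = cross0 (model p u) (model p v)" by simp_all
qed

section \<open>The Levi-Civita connection, smoothness of the metric and the squared
  endomorphism\<close>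

lemma connection_D: "connection A D"
  using levi_civita by (simp add: levi_civita_def)

lemma D_vector_field: "X \<in> vector_fields A \<Longrightarrow> Y \<in> vector_fields A \<Longrightarrow> D X Y \<in> vector_fields A"
  using connection_D by (simp add: connection_def)

lemma D_metric:
  "X \<in> vector_fields A \<Longrightarrow> Y \<in> vector_fields A \<Longrightarrow> Z \<in> vector_fields A \<Longrightarrow>
    X p (\<lambda>q. pc_metric A \<omega> q (Y q) (Z q))
      = pc_metric A \<omega> p (D X Y p) (Z p) + pc_metric A \<omega> p (Y p) (D X Z p)"
  using levi_civita unfolding levi_civita_def deriv_along_def by blast

text \<open>Smoothness of the metric can be read off the Levi-Civita connection instead of the 3-form.
  If \<open>h = g(Y,Z)\<close> is not smooth then \<open>\<xi> h = 0\<close>, as tangent vectors vanish on non-smooth functions,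
  and metric compatibility for \<open>f Y\<close> and \<open>Z\<close> gives \<open>\<xi>(f h) = (\<xi> f) h\<close>. One of \<open>f h\<close> and \<open>(f + 1) h\<close>
  is not smooth either, so \<open>(\<xi> f) h = 0\<close> for every smooth \<open>f\<close>; but \<open>\<xi>\<close> vanishes nowhere.\<close>

lemma smooth_pc_metric:
  assumes Y: "Y \<in> vector_fields A" and Z: "Z \<in> vector_fields A"
  shows "(\<lambda>q. pc_metric A \<omega> q (Y q) (Z q)) \<in> smooth_functions A" (is "?h \<in> _")
proof (rule ccontr)
  assume h: "?h \<notin> smooth_functions A"
  have nonsmooth: "\<xi> p f = 0" if "f \<notin> smooth_functions A" for p f
    using vector_field_tangent[OF xi, of p] that by (simp add: tangent_space_def)
  note T = vector_field_tangent
  have product: "\<xi> p (\<lambda>q. f q * ?h q) = \<xi> p f * ?h p" if f: "f \<in> smooth_functions A" for p f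
  proof -
    have "D \<xi> (vscale f Y) p = tadd (tscale (\<xi> p f) (Y p)) (tscale (f p) (D \<xi> Y p))"
      using connection_D f xi Y by (simp add: connection_def vadd_def vscale_def deriv_along_def)
    moreover have "\<xi> p (\<lambda>q. pc_metric A \<omega> q (vscale f Y q) (Z q)) =
        pc_metric A \<omega> p (D \<xi> (vscale f Y) p) (Z p) + pc_metric A \<omega> p (vscale f Y p) (D \<xi> Z p)"
      by (rule D_metric[OF xi vector_fields_vscale[OF f Y] Z])
    \<comment> \<open>Stated for every \<open>Z'\<close> because it is applied both to
      \<open>Z\<close> and to \<open>D \<xi> Z\<close>.\<close>
    moreover have "pc_metric A \<omega> q (vscale f Y q) (Z' q) = f q * pc_metric A \<omega> q (Y q) (Z' q)" for q Z'
      by (simp add: pc_metric_def g43_model vscale_def model_tscale T Y g0_commute[of "_ *\<^sub>R _"] g0_right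
          g0_commute[of _ "model q (Y q)"])
    ultimately have "\<xi> p (\<lambda>q. f q * ?h q) =
        \<xi> p f * ?h p + f p * (pc_metric A \<omega> p (D \<xi> Y p) (Z p) + pc_metric A \<omega> p (Y p) (D \<xi> Z p))"
      using T[OF Y, of p] T[OF D_vector_field[OF xi Y], of p]
      by (simp add: pc_metric_def g43_model model_tadd model_tscale tangent_space_tscale
          g0_commute[of _ "model p (Z p)"] g0_right algebra_simps)
    then show ?thesis using D_metric[OF xi Y Z, of p] nonsmooth[OF h, of p] by simp
  qed
  have vanish: "\<xi> p f * ?h p = 0" if f: "f \<in> smooth_functions A" for p f
  proof (cases "(\<lambda>q. f q * ?h q) \<in> smooth_functions A")
    case False
    then show ?thesis using product[OF f] nonsmooth by metis
  next
    case True
    have f1: "(\<lambda>q. f q + 1) \<in> smooth_functions A"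
      by (rule smooth_functions_add[OF f smooth_functions_const])
    have "(\<lambda>q. (f q + 1) * ?h q) \<notin> smooth_functions A"
    proof
      assume "(\<lambda>q. (f q + 1) * ?h q) \<in> smooth_functions A"
      from smooth_functions_add[OF this smooth_functions_mult[OF smooth_functions_const[of "-1"] True]] h
      show False by (simp add: algebra_simps)
    qed
    then have "\<xi> p (\<lambda>q. f q + 1) * ?h p = 0" using product[OF f1] nonsmooth by metis
    then show ?thesis
      using tangent_spaceD(1)[OF T[OF xi, of p] f smooth_functions_const[of 1]]
        tangent_space_const[OF T[OF xi, of p]] by simp
  qed
  \<comment> \<open>The zero function is smooth, so \<open>?h\<close> is not identically 0.\<close>
  obtain p where "?h p \<noteq> 0"
    using h smooth_functions_const[of 0] by (metis (no_types, lifting) ext)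
  then have "\<xi> p f = 0" for f using vanish[of f p] nonsmooth[of f p] by fastforce
  then have "\<xi> p = tzero" by (auto simp: tzero_def)
  then show False using xi_norm[of p] by (simp add: g43_model model_tzero g0_right)
qed

text \<open>This is \<phi>^2 = I - \<eta> \<otimes> \<xi>, from \<open>cross0_cross0\<close> with
  \<open>g0 x x = -1\<close>. Written through \<open>vadd\<close> and \<open>vscale\<close>, it
  shows that the result is again a smooth vector field.\<close>

lemma pc_endo_pc_endo:
  assumes Z: "Z \<in> vector_fields A"
  shows "pc_endo A \<omega> \<xi> (pc_endo A \<omega> \<xi> Z) = vadd Z (vscale (\<lambda>q. - 1 * pc_metric A \<omega> q (\<xi> q) (Z q)) \<xi>)"
proof
  fix p
  have T: "\<xi> p \<in> tangent_space A p" "Z p \<in> tangent_space A p"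
    using xi Z by (simp_all add: vector_field_tangent)
  show "pc_endo A \<omega> \<xi> (pc_endo A \<omega> \<xi> Z) p = vadd Z (vscale (\<lambda>q. - 1 * pc_metric A \<omega> q (\<xi> q) (Z q)) \<xi>) p"
    unfolding pc_endo_def vadd_def vscale_def
    using xi_norm[of p] T
    by (subst model_inject[symmetric, of _ p])
      (simp_all add: cross_tangent model_cross tangent_space_tadd tangent_space_tscale model_tadd model_tscale
        pc_metric_def g43_model cross0_cross0)
qed

lemma pc_endo_pc_endo_vector_field:
  "Z \<in> vector_fields A \<Longrightarrow> pc_endo A \<omega> \<xi> (pc_endo A \<omega> \<xi> Z) \<in> vector_fields A"
  unfolding pc_endo_pc_endo
  by (intro vector_fields_vadd vector_fields_vscale smooth_functions_mult smooth_functions_const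
      smooth_pc_metric xi)

section \<open>The covariant derivative of the fundamental form along \<xi>\<close>

lemma fundamental_form_eq:
  "u \<in> tangent_space A p \<Longrightarrow> v \<in> tangent_space A p \<Longrightarrow>
    fundamental_form A \<omega> \<xi> p u v = - phi0 (model p (\<xi> p)) (model p u) (model p v)"
  using vector_field_tangent[OF xi, of p]
  by (simp add: fundamental_form_def pc_metric_def g43_model model_cross g0_cross0)

text \<open>Since \<Phi>(\<xi>, -) = 0, both the differentiated function and the term with
  \<open>D \<xi> W\<close> vanish. The remaining term is -\<Phi>(\<open>D \<xi> \<xi>\<close>, W),
  and its sign cancels the one from g = -\<open>g43\<close>.\<close>

lemma pc_F_xi_xi:
  assumes W: "W \<in> vector_fields A"
  shows "pc_F A \<omega> \<xi> D \<xi> \<xi> W p = phi0 (model p (\<xi> p)) (model p (D \<xi> \<xi> p)) (model p (W p))"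
proof -
  note T = vector_field_tangent
  have "(\<lambda>q. fundamental_form A \<omega> \<xi> q (\<xi> q) (W q)) = (\<lambda>q. 0)"
    using T[OF xi] T[OF W] by (simp add: fundamental_form_eq phi0_same)
  then show ?thesis
    using T[OF xi, of p] T[OF W, of p] T[OF D_vector_field[OF xi xi], of p]
      T[OF D_vector_field[OF xi W], of p] tangent_space_const
    by (simp add: pc_F_def nabla_form2_def deriv_along_def fundamental_form_eq phi0_same)
qed

text \<open>The \<xi>-component of \<phi>^2 Z contributes a multiple of \<open>phi0 x y x\<close>,
  which is 0.\<close>

lemma pc_F_xi_xi_pc_endo_pc_endo:
  assumes Z: "Z \<in> vector_fields A"
  shows "pc_F A \<omega> \<xi> D \<xi> \<xi> (pc_endo A \<omega> \<xi> (pc_endo A \<omega> \<xi> Z)) p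
    = phi0 (model p (\<xi> p)) (model p (D \<xi> \<xi> p)) (model p (Z p))"
  using pc_F_xi_xi[OF pc_endo_pc_endo_vector_field[OF Z], of p]
    vector_field_tangent[OF xi, of p] vector_field_tangent[OF Z, of p]
  unfolding pc_endo_pc_endo[OF Z]
  by (simp add: vadd_def vscale_def model_tadd model_tscale tangent_space_tscale phi0_right phi0_outer_eq)

lemma F12_eq_0_iff:
  "(\<forall>X\<in>vector_fields A. \<forall>Y\<in>vector_fields A. \<forall>Z\<in>vector_fields A. \<forall>p. F12 A \<omega> \<xi> D X Y Z p = 0)
    \<longleftrightarrow> (\<forall>p. D \<xi> \<xi> p = tzero)"
proof (intro iffI allI ballI)
  fix p
  assume F12: "\<forall>X\<in>vector_fields A. \<forall>Y\<in>vector_fields A. \<forall>Z\<in>vector_fields A. \<forall>p. F12 A \<omega> \<xi> D X Y Z p = 0"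
  have eta: "pc_eta A \<omega> \<xi> \<xi> p = 1" by (simp add: pc_eta_def pc_metric_def xi_norm)
  have "phi0 (model p (\<xi> p)) (model p (D \<xi> \<xi> p)) z = 0" for z
  proof -
    obtain u where u: "u \<in> tangent_space A p" "model p u = z" by (rule model_surj)
    obtain Z where Z: "Z \<in> vector_fields A" "Z p = u"
      using vector_field_through[OF model_bij model_tadd model_tscale u(1)] by metis
    \<comment> \<open>With X = Y = \<xi> the factors \<eta>(X) and \<eta>(Y) are 1, and the
      subtracted term contains F(\<xi>, \<xi>, \<phi>^2 \<xi>) = 0, so only F(\<xi>, \<xi>, \<phi>^2
      Z) is left.\<close>
    have "F12 A \<omega> \<xi> D \<xi> \<xi> Z p = 0" using F12 xi Z(1) by blast
    then show ?thesis
      using Z u(2) by (simp add: F12_def eta pc_F_xi_xi_pc_endo_pc_endo xi phi0_outer_eq)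
  qed
  \<comment> \<open>The function g(\<xi>, \<xi>) is constantly 1, so metric compatibility gives 0 =
    2 g(\<open>D \<xi> \<xi>\<close>, \<xi>).\<close>
  moreover have "g0 (model p (\<xi> p)) (model p (D \<xi> \<xi> p)) = 0"
    using D_metric[OF xi xi xi, of p] xi_norm tangent_space_const[OF vector_field_tangent[OF xi, of p]]
    by (simp add: pc_metric_def g43_model g0_commute[of "model p (D \<xi> \<xi> p)"])
  moreover have "g0 (model p (\<xi> p)) (model p (\<xi> p)) = -1"
    using xi_norm by (simp add: g43_model)
  ultimately have "model p (D \<xi> \<xi> p) = model p tzero"
    unfolding model_tzero by (intro cross0_eq_0_imp)
  then show "D \<xi> \<xi> p = tzero"
    using model_inject tzero_tangent vector_field_tangent D_vector_field xi by blast
next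
  fix X Y Z p assume "\<forall>p. D \<xi> \<xi> p = tzero" "Y \<in> vector_fields A" "Z \<in> vector_fields A"
  then show "F12 A \<omega> \<xi> D X Y Z p = 0"
    by (simp add: F12_def pc_F_xi_xi_pc_endo_pc_endo model_tzero phi0_middle_zero)
qed

end

theorem theorem1:
  fixes A :: "('m::{t2_space, second_countable_topology}) chart set"
    and \<omega> :: "'m form3"
    and \<xi> :: "'m vfield"
    and D :: "'m vfield \<Rightarrow> 'm vfield \<Rightarrow> 'm vfield"
  assumes "smooth_oriented_manifold A"
    and "G2star_structure A \<omega>"
    and "\<xi> \<in> vector_fields A"
    and "\<And>p. g43 A \<omega> p (\<xi> p) (\<xi> p) = -1"
    and "levi_civita A (pc_metric A \<omega>) D"
  shows "(\<forall>X\<in>vector_fields A. \<forall>Y\<in>vector_fields A. \<forall>Z\<in>vector_fields A. \<forall>p.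
            F12 A \<omega> \<xi> D X Y Z p = 0)
         \<longleftrightarrow> (\<forall>p. D \<xi> \<xi> p = tzero)"
proof -
  interpret G2star_unit_field A \<omega> \<xi> D
    by unfold_locales (use assms in auto)
  show ?thesis by (rule F12_eq_0_iff)
qed

end
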